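(* Let $K\subset[0,1]$ be the attractor of a homogeneous linear iterated function system $\{\phi_j(x)=\rho x+a_j\}_{j=1}^L$ satisfying the strong separation condition, let $T:K\to K$ be the map induced by the shift, and let $\gamma:=\dim_H K=\frac{\log L}{-\log\rho}$. Let $\varphi:\mathbb{N}\to\mathbb{R}^+$ be a positive function and set $$R(\varphi):=\{x\in K:\ |T^n x-x|<\varphi(n)\ \text{for infinitely many } n\in\mathbb{N}\}.$$ Then $$\dim_H R(\varphi)=\frac{\gamma}{1+b}\quad\text{with}\quad b=\liminf_{n\to\infty}\frac{\log_\rho\varphi(n)}{n}.$$
   Context: Setting. Let $L\ge 2$ be an integer, $\rho\in(0,1)$, and $0\le a_1<\cdots<a_L\le 1-\rho$. Put $\phi_j(x)=\rho x+a_j$ on $[0,1]$ for $1\le j\le L$. The attractor $K$ is the unique non-empty compact subset of $[0,1]$ with $K=\bigcup_{j=1}^L\phi_j(K)$. The strong separation condition means that the sets $\phi_1(K),\dots,\phi_L(K)$ are pairwise disjoint (as a consequence $\rho<1/L$). Coding. Let $\Lambda=\{1,\dots,L\}$. For $\epsilon=(\epsilon_1,\epsilon_2,\dots)\in\Lambda^{\mathbb{N}}$ let $\pi(\epsilon)$ be the unique point of $\bigcap_{n\ge1}\phi_{\epsilon_1}\circ\cdots\circ\phi_{\epsilon_n}([0,1])$. Then $K=\pi(\Lambda^{\mathbb{N}})$, and each $x\in K$ is taken to have a unique coding, i.e. a unique $\epsilon$ with $\pi(\epsilon)=x$. Map. $T:K\to K$ is defined by $Tx=\pi(\sigma(\epsilon))$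 where $\epsilon$ is the coding of $x$ and $\sigma$ is the left shift on $\Lambda^{\mathbb{N}}$. Here $\dim_H$ is Hausdorff dimension, $\log_\rho$ is the logarithm to base $\rho$ (so $\log_\rho t=\log t/\log\rho$), $|\cdot|$ is the Euclidean metric, $\mathbb{N}=\{1,2,\dots\}$, and $\mathbb{R}^+=(0,\infty)$. When $b=\infty$, $\frac{\gamma}{1+b}$ is read as $0$.
   Formalization: The formal theorem adds the hypothesis b ≥ 0 (b = ∞ allowed); for b < 0 one has φ(n) > 1 infinitely often, so R(φ) = K has dimension γ, and the formula γ/(1+b) is false (or undefined at b = -1). *)

theory Defs
  imports "HOL-Analysis.Analysis"
begin

section \<open>Hausdorff measure and dimension\<close>

text \<open>
  \<open>diam U ^ s\<close> with the usual conventions \<open>diam {} ^ s = 0\<close> and \<open>0 ^ 0 = 1\<close> for non-empty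
  \<open>U\<close> (in the library, \<open>0 powr 0 = 0\<close>), so that \<open>s = 0\<close> gives counting measure.
\<close>
definition diam_pow :: "real \<Rightarrow> 'a::metric_space set \<Rightarrow> ennreal" where
  "diam_pow s U =
     (if U = {} then 0 else if s = 0 then 1 else ennreal (diameter U powr s))"

text \<open>
  Boundedness of the covering sets has to be required separately, since \<^const>\<open>diameter\<close> is not
  meaningful on unbounded sets.
\<close>
definition hausdorff_premeasure :: "real \<Rightarrow> real \<Rightarrow> 'a::metric_space set \<Rightarrow> ennreal" where
  "hausdorff_premeasure s \<delta> A =
     Inf {(\<Sum>i. diam_pow s (U i)) | U :: nat \<Rightarrow> 'a set.
            A \<subseteq> (\<Union>i. U i) \<and> (\<forall>i. bounded (U i) \<and> diameter (U i) \<le> \<delta>)}"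

definition hausdorff_measure :: "real \<Rightarrow> 'a::metric_space set \<Rightarrow> ennreal" where
  "hausdorff_measure s A = (SUP \<delta>\<in>{0<..}. hausdorff_premeasure s \<delta> A)"

definition hausdorff_dim :: "'a::metric_space set \<Rightarrow> ereal" where
  "hausdorff_dim A = Inf {ereal s | s. 0 \<le> s \<and> hausdorff_measure s A = 0}"

section \<open>Homogeneous linear iterated function systems on the unit interval\<close>

text \<open>The translations are \<open>a 1, \<dots>, a L\<close>; the values of \<open>a\<close> at other indices are irrelevant.\<close>

definition ifs_map :: "real \<Rightarrow> (nat \<Rightarrow> real) \<Rightarrow> nat \<Rightarrow> real \<Rightarrow> real" where
  "ifs_map \<rho> a j x = \<rho> * x + a j"

definition homogeneous_ifs :: "nat \<Rightarrow> real \<Rightarrow> (nat \<Rightarrow> real) \<Rightarrow> bool" where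
  "homogeneous_ifs L \<rho> a \<longleftrightarrow>
     2 \<le> L \<and> 0 < \<rho> \<and> \<rho> < 1 \<and> 0 \<le> a 1 \<and> strict_mono_on {1..L} a \<and> a L \<le> 1 - \<rho>"

definition is_attractor :: "nat \<Rightarrow> real \<Rightarrow> (nat \<Rightarrow> real) \<Rightarrow> real set \<Rightarrow> bool" where
  "is_attractor L \<rho> a K \<longleftrightarrow>
     K \<noteq> {} \<and> compact K \<and> K \<subseteq> {0..1} \<and> K = (\<Union>j\<in>{1..L}. ifs_map \<rho> a j ` K)"

definition strong_separation :: "nat \<Rightarrow> real \<Rightarrow> (nat \<Rightarrow> real) \<Rightarrow> real set \<Rightarrow> bool" where
  "strong_separation L \<rho> a K \<longleftrightarrow> disjoint_family_on (\<lambda>j. ifs_map \<rho> a j ` K) {1..L}"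

section \<open>Coding and the shift-induced map\<close>

text \<open>
  A symbolic sequence \<open>(\<epsilon>\<^sub>1, \<epsilon>\<^sub>2, \<dots>)\<close> over \<open>{1..L}\<close> is represented by a function on \<^typ>\<open>nat\<close>
  whose value at \<open>i\<close> is \<open>\<epsilon>\<close> with index \<open>i + 1\<close>.
\<close>
definition symbolic_space :: "nat \<Rightarrow> (nat \<Rightarrow> nat) set" where
  "symbolic_space L = {\<epsilon>. \<forall>i. \<epsilon> i \<in> {1..L}}"

definition left_shift :: "(nat \<Rightarrow> nat) \<Rightarrow> nat \<Rightarrow> nat" where
  "left_shift \<epsilon> = (\<lambda>i. \<epsilon> (Suc i))"

primrec ifs_comp :: "real \<Rightarrow> (nat \<Rightarrow> real) \<Rightarrow> (nat \<Rightarrow> nat) \<Rightarrow> nat \<Rightarrow> real \<Rightarrow> real" where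
  "ifs_comp \<rho> a \<epsilon> 0 = id"
| "ifs_comp \<rho> a \<epsilon> (Suc n) = ifs_comp \<rho> a \<epsilon> n \<circ> ifs_map \<rho> a (\<epsilon> n)"

definition coding_map :: "real \<Rightarrow> (nat \<Rightarrow> real) \<Rightarrow> (nat \<Rightarrow> nat) \<Rightarrow> real" where
  "coding_map \<rho> a \<epsilon> = (THE x. x \<in> (\<Inter>n\<in>{1..}. ifs_comp \<rho> a \<epsilon> n ` {0..1}))"

definition coding :: "nat \<Rightarrow> real \<Rightarrow> (nat \<Rightarrow> real) \<Rightarrow> real \<Rightarrow> nat \<Rightarrow> nat" where
  "coding L \<rho> a x = (THE \<epsilon>. \<epsilon> \<in> symbolic_space L \<and> coding_map \<rho> a \<epsilon> = x)"

definition ifs_shift :: "nat \<Rightarrow> real \<Rightarrow> (nat \<Rightarrow> real) \<Rightarrow> real \<Rightarrow> real" where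
  "ifs_shift L \<rho> a x = coding_map \<rho> a (left_shift (coding L \<rho> a x))"

definition recurrence_set :: "real set \<Rightarrow> (real \<Rightarrow> real) \<Rightarrow> (nat \<Rightarrow> real) \<Rightarrow> real set" where
  "recurrence_set K T \<phi> = {x \<in> K. infinite {n. 1 \<le> n \<and> \<bar>(T ^^ n) x - x\<bar> < \<phi> n}}"

end

theory Submission
  imports Defs
begin

text \<open>
  Points of the attractor are coded by sequences over \<open>{1..L}\<close>. Two points whose codings first
  differ at index \<open>N\<close> are at distance comparable to \<open>\<rho> ^ N\<close>, where the lower estimate comes from
  strong separation, and there are \<open>L ^ N\<close> cylinders of level \<open>N\<close>, with \<open>L = \<rho> powr (- \<gamma>)\<close>.
  By the definition of \<open>b\<close>, the comparison of \<open>\<phi> n\<close> with \<open>\<rho> powr (c * n)\<close> is settled for all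
  large \<open>n\<close> when \<open>c < b\<close>, and goes in the other direction for infinitely many \<open>n\<close> when \<open>c > b\<close>.
  So it suffices to treat radii \<open>\<rho> powr (c * n)\<close>.

  Upper bound. On a cylinder of level \<open>n\<close> the map \<open>T ^^ n\<close> is affine with slope \<open>1 / \<rho> ^ n\<close>, so
  its approximate fixed points there are close together: the points of the cylinder that return within
  \<open>\<rho> powr (c * n)\<close> at time \<open>n\<close> form a set of diameter at most a constant times
  \<open>\<rho> powr ((1 + c) * n)\<close>. The \<open>L ^ n\<close> sets obtained for each \<open>n\<close> form a cover with convergent
  \<open>s\<close>-sum as soon as \<open>s > \<gamma> / (1 + c)\<close>, and the limsup set has measure zero
  (\<open>hausdorff_measure_limsup_eq_0\<close>, \<open>hausdorff_measure_recurrent_eq_0\<close>).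

  Lower bound. Choose very sparse times \<open>n\<close> with \<open>\<phi> n > \<rho> powr (c * n)\<close> and consider the
  codings in which the block of length about \<open>c * n\<close> that starts at \<open>n\<close> repeats the beginning of
  the sequence. All of them return in time. The other positions are free, and because the times
  are sparse, among the first \<open>N\<close> positions at least \<open>\<theta> * N - 2\<close> are free, for any given
  \<open>\<theta> < 1 / (1 + c)\<close> (\<open>ex_copying_scheme\<close>). Writing the base-\<open>L\<close> digits of \<open>t\<close> in \<open>[0, 1)\<close> into
  the free positions parametrizes a subset of the recurrence set by \<open>[0, 1)\<close>; the inverse of this
  parametrization is Hoelder with exponent \<open>\<gamma> * \<theta>\<close>. Lebesgue measure on \<open>[0, 1)\<close> thereby plays
  the part of the mass distribution (\<open>hausdorff_measure_nonzero_of_Hoelder_inverse\<close>), and no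
  measure on the attractor has to be constructed.

  The dimension of the attractor itself is the case \<open>c = 0\<close> of both bounds, since every return
  distance is at most \<open>1\<close>.
\<close>

section \<open>Bounds for Hausdorff measure and dimension\<close>

lemma hausdorff_measure_mono:
  assumes "A \<subseteq> B"
  shows "hausdorff_measure s A \<le> hausdorff_measure s B"
  unfolding hausdorff_measure_def hausdorff_premeasure_def
  by (intro SUP_mono' Inf_superset_mono) (use assms in blast)

lemma hausdorff_dim_le:
  assumes "\<And>s. 0 \<le> s \<Longrightarrow> d < ereal s \<Longrightarrow> hausdorff_measure s A = 0" and "0 \<le> d"
  shows "hausdorff_dim A \<le> d"
proof (rule dense_ge)
  fix e assume "d < e"
  then obtain s where s: "d < ereal s" "ereal s < e"
    using ereal_dense2 by blast
  with \<open>0 \<le> d\<close> have "0 \<le> s"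
    by (metis ereal_less_eq(5) less_imp_le order_trans)
  with s assms(1) have "hausdorff_dim A \<le> ereal s"
    unfolding hausdorff_dim_def by (intro Inf_lower) blast
  with s show "hausdorff_dim A \<le> e" by simp
qed

lemma hausdorff_dim_ge:
  assumes "\<And>s. 0 \<le> s \<Longrightarrow> ereal s < d \<Longrightarrow> hausdorff_measure s A \<noteq> 0"
  shows "d \<le> hausdorff_dim A"
  unfolding hausdorff_dim_def using assms by (intro Inf_greatest) (auto simp: not_less[symmetric])

text \<open>
  The Borel-Cantelli argument for Hausdorff measure: each tail of the families \<open>\<U> n\<close> covers \<open>A\<close>,
  with arbitrarily small total \<open>s\<close>-sum and arbitrarily small diameters.
\<close>
lemma hausdorff_measure_limsup_eq_0:
  fixes \<U> :: "nat \<Rightarrow> 'a::metric_space set set"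
  assumes "0 < s"
    and fin: "\<And>n. finite (\<U> n)" "\<And>n. card (\<U> n) \<le> M n"
    and diam: "\<And>n U. U \<in> \<U> n \<Longrightarrow> bounded U" "\<And>n U. U \<in> \<U> n \<Longrightarrow> diameter U \<le> r n"
    and r: "r \<longlonglongrightarrow> 0" "\<And>n. 0 \<le> r n"
    and summable: "summable (\<lambda>n. real (M n) * r n powr s)"
    and A: "\<And>x. x \<in> A \<Longrightarrow> infinite {n. x \<in> \<Union>(\<U> n)}"
  shows "hausdorff_measure s A = 0"
proof -
  let ?w = "\<lambda>n. real (M n) * r n powr s"
  have le_eps: "hausdorff_premeasure s \<delta> A \<le> ennreal e" if "0 < \<delta>" "0 < e" for \<delta> e
  proof -
    have "eventually (\<lambda>n. r n < \<delta>) sequentially"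
      using r(1) \<open>0 < \<delta>\<close> by (rule order_tendstoD)
    moreover obtain N1 where N1: "\<And>n. n \<ge> N1 \<Longrightarrow> norm (\<Sum>i. ?w (i + n)) < e"
      using suminf_exist_split[OF \<open>0 < e\<close> summable] by blast
    ultimately obtain N where N: "N \<ge> N1" "\<And>n. n \<ge> N \<Longrightarrow> r n < \<delta>"
      unfolding eventually_sequentially by (metis nat_le_linear order_trans)
    have "\<exists>f. bij_betw f {..<card (\<U> n)} (\<U> n)" for n
      using ex_bij_betw_nat_finite[OF fin(1)[of n]] by (simp add: atLeast0LessThan)
    then obtain f where f: "\<And>n. bij_betw (f n) {..<card (\<U> n)} (\<U> n)" by metis
    \<comment> \<open>The tail families are arranged in one sequence through the pairing of \<open>nat \<times> nat\<close>, padded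
      with empty sets, whose \<^const>\<open>diam_pow\<close> is zero.\<close>
    define V where "V n k = (if k < card (\<U> (n + N)) then f (n + N) k else {})" for n k
    have V_cases: "V n k = {} \<or> V n k \<in> \<U> (n + N)" for n k
      using f[of "n + N"] by (auto simp: V_def bij_betw_def)
    have sum_V: "(\<Sum>k. diam_pow s (V n k)) \<le> ennreal (?w (n + N))" for n
    proof -
      have "(\<Sum>k. diam_pow s (V n k)) = (\<Sum>k<card (\<U> (n + N)). diam_pow s (V n k))"
        by (rule suminf_finite) (auto simp: V_def diam_pow_def)
      also have "\<dots> \<le> (\<Sum>k<card (\<U> (n + N)). ennreal (r (n + N) powr s))"
      proof (rule sum_mono)
        fix k
        show "diam_pow s (V n k) \<le> ennreal (r (n + N) powr s)"
        proof (cases "V n k = {}")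
          case False
          with V_cases[of n k] have "V n k \<in> \<U> (n + N)" by simp
          from diam[OF this] \<open>0 < s\<close> show ?thesis
            by (auto simp: diam_pow_def intro!: ennreal_leI powr_mono2 diameter_ge_0)
        qed (simp add: diam_pow_def)
      qed
      also have "\<dots> = ennreal (real (card (\<U> (n + N))) * r (n + N) powr s)"
        by (simp add: ennreal_mult ennreal_of_nat_eq_real_of_nat)
      also have "\<dots> \<le> ennreal (?w (n + N))"
        using fin(2)[of "n + N"] by (intro ennreal_leI mult_right_mono) auto
      finally show ?thesis .
    qed
    define W where "W i = (case prod_decode i of (n, k) \<Rightarrow> V n k)" for i
    have "(\<Sum>i. diam_pow s (W i)) = (\<Sum>n. \<Sum>k. diam_pow s (V n k))"
      using suminf_ennreal_2dimen[OF refl, of "\<lambda>(n, k). diam_pow s (V n k)"]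
      by (simp add: W_def o_def case_prod_unfold)
    also have "\<dots> \<le> (\<Sum>n. ennreal (?w (n + N)))"
      by (intro suminf_le sum_V) auto
    also have "\<dots> = ennreal (\<Sum>n. ?w (n + N))"
      by (rule suminf_ennreal2) (use summable in \<open>auto simp: summable_iff_shift[of ?w]\<close>)
    also have "\<dots> \<le> ennreal e"
      using N1[OF N(1)] by (intro ennreal_leI) auto
    finally have sum_W: "(\<Sum>i. diam_pow s (W i)) \<le> ennreal e" .
    have "A \<subseteq> (\<Union>i. W i)"
    proof
      fix x assume "x \<in> A"
      from A[OF this] have "\<exists>n\<ge>N. n \<in> {n. x \<in> \<Union>(\<U> n)}"
        unfolding infinite_nat_iff_unbounded_le by (rule spec)
      then obtain n where n: "n \<ge> N" "x \<in> \<Union>(\<U> n)" by auto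
      then obtain U where "U \<in> \<U> n" "x \<in> U" by blast
      then obtain k where "k < card (\<U> n)" "x \<in> f n k"
        using f[of n] by (auto simp: bij_betw_def)
      with n have "x \<in> V (n - N) k" by (simp add: V_def)
      then have "x \<in> W (prod_encode (n - N, k))" by (simp add: W_def)
      then show "x \<in> (\<Union>i. W i)" by blast
    qed
    moreover have "bounded (W i) \<and> diameter (W i) \<le> \<delta>" for i
    proof (cases "prod_decode i")
      case (Pair n k)
      then have "W i = V n k" by (simp add: W_def)
      with V_cases[of n k] diam N(2)[of "n + N"] \<open>0 < \<delta>\<close> show ?thesis
        by (fastforce simp: diameter_empty)
    qed
    ultimately have "hausdorff_premeasure s \<delta> A \<le> (\<Sum>i. diam_pow s (W i))"
      unfolding hausdorff_premeasure_def by (intro Inf_lower) blast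
    with sum_W show ?thesis by simp
  qed
  have "hausdorff_premeasure s \<delta> A \<le> 0" if "0 < \<delta>" for \<delta>
  proof (rule ennreal_le_epsilon)
    fix e :: real assume "0 < e"
    from le_eps[OF that this] show "hausdorff_premeasure s \<delta> A \<le> 0 + ennreal e" by simp
  qed
  then show ?thesis
    unfolding hausdorff_measure_def by (auto simp: le_zero_eq intro!: SUP_eq_const)
qed

text \<open>
  A mass distribution principle with Lebesgue measure as the mass: a covering set \<open>U\<close> pulls back
  to a subset of an interval of length \<open>C * diameter U powr s\<close>, and these intervals cover \<open>[0, 1)\<close>.
  For \<open>s = 0\<close> the hypothesis makes \<open>g\<close> injective, since \<open>0 powr 0 = 0\<close>.
\<close>
lemma hausdorff_measure_nonzero_of_Hoelder_inverse:
  fixes g :: "real \<Rightarrow> 'a::metric_space"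
  assumes "0 \<le> s" "0 < C"
    and g: "\<And>t t'. t \<in> {0..<1} \<Longrightarrow> t' \<in> {0..<1} \<Longrightarrow> \<bar>t - t'\<bar> \<le> C * dist (g t) (g t') powr s"
    and A: "g ` {0..<1} \<subseteq> A"
  shows "hausdorff_measure s A \<noteq> 0"
proof -
  have "ennreal (1 / C) \<le> hausdorff_premeasure s 1 A"
    unfolding hausdorff_premeasure_def
  proof (rule Inf_greatest, safe)
    fix U :: "nat \<Rightarrow> 'a set"
    assume cover: "A \<subseteq> (\<Union>i. U i)" and U: "\<forall>i. bounded (U i) \<and> diameter (U i) \<le> 1"
    define D where "D i = {t \<in> {0..<1}. g t \<in> U i}" for i
    have D: "\<exists>B \<in> sets lborel. D i \<subseteq> B \<and> emeasure lborel B \<le> ennreal C * diam_pow s (U i)" for i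
    proof (cases "D i = {}")
      case True
      then show ?thesis by (intro bexI[of _ "{}"]) auto
    next
      case False
      then have "U i \<noteq> {}" by (auto simp: D_def)
      define d where "d = C * (if s = 0 then 1 else diameter (U i) powr s)"
      have d: "\<bar>t - t'\<bar> \<le> d" if "t \<in> D i" "t' \<in> D i" for t t'
      proof -
        have "\<bar>t - t'\<bar> \<le> C * dist (g t) (g t') powr s"
          using that by (intro g) (auto simp: D_def)
        also have "dist (g t) (g t') powr s \<le> (if s = 0 then 1 else diameter (U i) powr s)"
          using \<open>0 \<le> s\<close> U that
          by (auto simp: D_def intro!: powr_mono2 diameter_bounded_bound)
        finally show ?thesis using \<open>0 < C\<close> by (simp add: d_def)
      qed
      have bdd: "bdd_below (D i)" by (rule bdd_belowI[of _ 0]) (auto simp: D_def)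
      have "D i \<subseteq> {Inf (D i)..Inf (D i) + d}"
      proof
        fix t assume t: "t \<in> D i"
        have "t - d \<le> Inf (D i)"
          using False d[OF t] by (intro cInf_greatest) (auto simp: abs_le_iff algebra_simps)
        with cInf_lower[OF t bdd] show "t \<in> {Inf (D i)..Inf (D i) + d}" by simp
      qed
      moreover have "0 \<le> d" using \<open>0 < C\<close> by (simp add: d_def)
      then have "emeasure lborel {Inf (D i)..Inf (D i) + d} = ennreal C * diam_pow s (U i)"
        using \<open>0 < C\<close> \<open>U i \<noteq> {}\<close> by (auto simp: d_def diam_pow_def ennreal_mult)
      ultimately show ?thesis by (intro bexI[of _ "{Inf (D i)..Inf (D i) + d}"]) auto
    qed
    then obtain B where B: "\<And>i. B i \<in> sets lborel" "\<And>i. D i \<subseteq> B i"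
      "\<And>i. emeasure lborel (B i) \<le> ennreal C * diam_pow s (U i)" by metis
    have "{0..<1} \<subseteq> (\<Union>i. D i)" using cover A by (fastforce simp: D_def)
    also have "\<dots> \<subseteq> (\<Union>i. B i)" using B(2) by blast
    finally have "emeasure lborel {0..<1::real} \<le> emeasure lborel (\<Union>i. B i)"
      using B(1) by (intro emeasure_mono) auto
    also have "\<dots> \<le> (\<Sum>i. emeasure lborel (B i))"
      using B(1) by (intro emeasure_subadditive_countably) auto
    also have "\<dots> \<le> (\<Sum>i. ennreal C * diam_pow s (U i))"
      by (intro suminf_le B) auto
    finally have "1 \<le> ennreal C * (\<Sum>i. diam_pow s (U i))" by simp
    then have "ennreal (1 / C) * 1 \<le> ennreal (1 / C) * (ennreal C * (\<Sum>i. diam_pow s (U i)))"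
      by (intro mult_left_mono) auto
    also have "\<dots> = (\<Sum>i. diam_pow s (U i))"
      using \<open>0 < C\<close> by (simp add: mult.assoc[symmetric] ennreal_mult[symmetric])
    finally show "ennreal (1 / C) \<le> (\<Sum>i. diam_pow s (U i))" by simp
  qed
  also have "\<dots> \<le> hausdorff_measure s A"
    unfolding hausdorff_measure_def by (rule SUP_upper) simp
  finally show ?thesis using \<open>0 < C\<close> by auto
qed

section \<open>Base-L digits\<close>

text \<open>
  Digits are shifted by one, so that they are letters of the alphabet \<open>{1..L}\<close>.
\<close>
definition digit :: "nat \<Rightarrow> real \<Rightarrow> nat \<Rightarrow> nat" where
  "digit L t j = nat (\<lfloor>real L ^ Suc j * t\<rfloor> mod int L) + 1"

lemma digit_in:
  assumes "0 < L"
  shows "digit L t j \<in> {1..L}"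
proof -
  have "0 \<le> \<lfloor>real L ^ Suc j * t\<rfloor> mod int L" "\<lfloor>real L ^ Suc j * t\<rfloor> mod int L < int L"
    using assms by simp_all
  then show ?thesis unfolding digit_def by auto
qed

lemma dist_le_of_digits_eq:
  assumes "2 \<le> L" and t: "t \<in> {0..<1}" "t' \<in> {0..<1}"
    and eq: "\<And>j. j < f \<Longrightarrow> digit L t j = digit L t' j"
  shows "\<bar>t - t'\<bar> \<le> 1 / real L ^ f"
proof -
  have "\<lfloor>real L ^ f * t\<rfloor> = \<lfloor>real L ^ f * t'\<rfloor>" using eq
  proof (induction f)
    case 0
    from t have "\<lfloor>t\<rfloor> = 0" "\<lfloor>t'\<rfloor> = 0" by (simp_all add: floor_eq_iff)
    then show ?case by simp
  next
    case (Suc f)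
    have div_L: "\<lfloor>real L ^ Suc f * u\<rfloor> div int L = \<lfloor>real L ^ f * u\<rfloor>" for u
    proof -
      have "\<lfloor>real L ^ Suc f * u\<rfloor> div int L = \<lfloor>real L ^ Suc f * u / real L\<rfloor>"
        using floor_divide_real_eq_div[of "int L" "real L ^ Suc f * u"] by simp
      then show ?thesis using \<open>2 \<le> L\<close> by simp
    qed
    have "\<lfloor>real L ^ Suc f * t\<rfloor> mod int L = \<lfloor>real L ^ Suc f * t'\<rfloor> mod int L"
      using Suc.prems[of f] \<open>2 \<le> L\<close> by (simp add: digit_def eq_nat_nat_iff)
    moreover have "\<lfloor>real L ^ Suc f * t\<rfloor> div int L = \<lfloor>real L ^ Suc f * t'\<rfloor> div int L"
      using Suc by (simp only: div_L)
    ultimately show ?case by (metis div_mult_mod_eq)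
  qed
  then have "\<bar>real L ^ f * t - real L ^ f * t'\<bar> \<le> 1" by linarith
  then have "real L ^ f * \<bar>t - t'\<bar> \<le> 1"
    by (simp add: right_diff_distrib[symmetric] abs_mult)
  with \<open>2 \<le> L\<close> show ?thesis by (simp add: field_simps)
qed

section \<open>Sequences with prescribed repetitions\<close>

lemma ex_infinite_sparse_subset:
  fixes A :: "nat set" and h :: "nat \<Rightarrow> nat"
  assumes "infinite A"
  obtains S where "S \<subseteq> A" "infinite S" "\<And>m n. m \<in> S \<Longrightarrow> n \<in> S \<Longrightarrow> m < n \<Longrightarrow> h m \<le> n"
proof -
  have "\<exists>y\<in>A. y > x \<and> y \<ge> h x" for x
    using assms unfolding infinite_nat_iff_unbounded_le
    by (metis Suc_le_eq max.bounded_iff)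
  then obtain nxt where nxt: "\<And>x. nxt x \<in> A" "\<And>x. nxt x > x" "\<And>x. nxt x \<ge> h x" by metis
  define s where "s k = (nxt ^^ Suc k) 0" for k
  have s_Suc: "s (Suc k) = nxt (s k)" for k by (simp add: s_def)
  have mono: "strict_mono s" by (simp add: strict_mono_Suc_iff s_Suc nxt)
  show thesis
  proof
    show "range s \<subseteq> A" by (auto simp: s_def nxt)
    show "infinite (range s)"
      using mono by (simp add: range_inj_infinite strict_mono_imp_inj_on)
    fix m n assume "m \<in> range s" "n \<in> range s" "m < n"
    then obtain i j where ij: "m = s i" "n = s j" "i < j"
      using mono by (auto simp: strict_mono_less)
    have "h (s i) \<le> s (Suc i)" by (simp add: s_Suc nxt)
    also have "\<dots> \<le> s j" using ij mono by (simp add: strict_mono_less_eq)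
    finally show "h m \<le> n" using ij by simp
  qed
qed

text \<open>
  Position \<open>i\<close> repeats the letter at position \<open>src i\<close> if this is an earlier one. The other
  positions, with \<open>\<not> src i < i\<close>, are free; they receive the letters \<open>d 0, d 1, \<dots>\<close> in order.
\<close>
function copy_fill :: "(nat \<Rightarrow> nat) \<Rightarrow> (nat \<Rightarrow> nat) \<Rightarrow> nat \<Rightarrow> nat" where
  "copy_fill src d i =
     (if src i < i then copy_fill src d (src i) else d (card {j. j < i \<and> \<not> src j < j}))"
  by auto
termination by (relation "Wellfounded.measure (\<lambda>(src, d, i). i)") auto

declare copy_fill.simps [simp del]

lemma copy_fill_in: "(\<And>j. d j \<in> A) \<Longrightarrow> copy_fill src d i \<in> A"
  by (induction src d i rule: copy_fill.induct) (subst copy_fill.simps, simp)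

text \<open>
  The letters of \<open>d\<close> that have been written up to position \<open>N\<close> can be read off at the free positions.
\<close>
lemma copy_fill_prefix_determines:
  assumes "\<And>i. i < N \<Longrightarrow> copy_fill src d i = copy_fill src d' i"
    and "j < card {i. i < N \<and> \<not> src i < i}"
  shows "d j = d' j"
  using assms
proof (induction N)
  case (Suc N)
  have *: "{i. i < Suc N \<and> \<not> src i < i} =
      (if src N < N then {i. i < N \<and> \<not> src i < i} else insert N {i. i < N \<and> \<not> src i < i})"
    by (auto simp: less_Suc_eq)
  show ?case
  proof (cases "j < card {i. i < N \<and> \<not> src i < i}")
    case True
    with Suc show ?thesis by simp
  next
    case False
    with Suc.prems(2) * have "\<not> src N < N" "j = card {i. i < N \<and> \<not> src i < i}"
      by (auto split: if_splits)
    with Suc.prems(1)[of N] show ?thesis by (simp add: copy_fill.simps[of src _ N])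
  qed
qed simp

text \<open>
  Blocks of length \<open>\<lceil>c * n\<rceil>\<close> are attached to the times \<open>n\<close> of a set \<open>S\<close> so sparse that each block
  ends at \<open>\<eta> * n'\<close> at the latest, where \<open>n'\<close> is any later time and \<open>\<eta> = 1 - \<theta> * (1 + c)\<close>. Then the blocks
  are disjoint, and the density of free positions is lowest at the end of a block, where only
  about \<open>(1 - \<eta>) * n\<close> of \<open>(1 + c) * n\<close> positions are free. This ratio is \<open>\<theta>\<close>; rounding costs at most two
  positions.
\<close>
lemma ex_copying_scheme:
  fixes A :: "nat set" and c \<theta> :: real
  assumes "infinite A" "0 \<notin> A" "0 \<le> c" "0 \<le> \<theta>" "\<theta> * (1 + c) < 1"
  obtains S src where "S \<subseteq> A" "infinite S"
    "\<forall>n\<in>S. \<forall>i<nat \<lceil>c * real n\<rceil>. src (n + i) = i"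
    "\<forall>N. \<theta> * real N - 2 \<le> real (card {i. i < N \<and> \<not> src i < i})"
proof -
  define \<eta> where "\<eta> = 1 - \<theta> * (1 + c)"
  have "\<theta> * 1 \<le> \<theta> * (1 + c)" using assms by (intro mult_left_mono) auto
  with assms have \<theta>_le: "\<theta> \<le> 1" by simp
  have \<eta>: "0 < \<eta>" "\<eta> \<le> 1" using assms by (simp_all add: \<eta>_def)
  define m where "m n = nat \<lceil>c * real n\<rceil>" for n
  have m: "real (m n) \<le> c * real n + 1" for n
    using \<open>0 \<le> c\<close> unfolding m_def by (simp add: of_nat_nat)
  obtain S where S: "S \<subseteq> A" "infinite S"
    and sparse: "\<And>n n'. n \<in> S \<Longrightarrow> n' \<in> S \<Longrightarrow> n < n' \<Longrightarrow> nat \<lceil>real (n + m n) / \<eta>\<rceil> \<le> n'"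
    using ex_infinite_sparse_subset[OF assms(1), of "\<lambda>n. nat \<lceil>real (n + m n) / \<eta>\<rceil>"] by blast
  have gap: "real (n + m n) \<le> \<eta> * real n'" if "n \<in> S" "n' \<in> S" "n < n'" for n n'
  proof -
    have "real (n + m n) / \<eta> \<le> real n'" using sparse[OF that] by linarith
    with \<eta> show ?thesis by (simp add: field_simps)
  qed
  have gap': "n + m n \<le> n'" if "n \<in> S" "n' \<in> S" "n < n'" for n n'
  proof -
    have "real (n + m n) \<le> real n'"
      using gap[OF that] mult_right_mono[OF \<eta>(2), of "real n'"] by simp
    then show ?thesis by linarith
  qed
  define in_block where "in_block n i \<longleftrightarrow> n \<in> S \<and> n \<le> i \<and> i < n + m n" for n i
  define src where "src i = (if \<exists>n. in_block n i then i - (THE n. in_block n i) else i)" for i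
  have unique: "n = n'" if "in_block n i" "in_block n' i" for n n' i
    using that gap'[of n n'] gap'[of n' n] unfolding in_block_def by (metis leD le_trans linorder_neqE_nat)
  have src_block: "src i = i - n" if "in_block n i" for n i
  proof -
    have "(THE n. in_block n i) = n" using that unique by blast
    with that show ?thesis by (auto simp: src_def)
  qed
  have free_iff: "\<not> src i < i \<longleftrightarrow> \<not> (\<exists>n. in_block n i)" for i
    by (metis S(1) \<open>0 \<notin> A\<close> diff_less in_block_def less_irrefl not_gr_zero not_le order_trans src_block src_def subsetD)
  have count: "\<theta> * real N - 2 \<le> real (card {i. i < N \<and> \<not> src i < i})" for N
  proof -
    let ?F = "{i. i < N \<and> \<not> src i < i}" and ?B = "{i. i < N \<and> (\<exists>n. in_block n i)}"
    have "{..<N} = ?F \<union> ?B" by (auto simp: free_iff)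
    then have card_F: "N \<le> card ?F + card ?B"
      by (metis card_Un_le card_lessThan)
    show ?thesis
    proof (cases "\<exists>n\<in>S. n \<le> N")
      case False
      then have "?B = {}" by (fastforce simp: in_block_def)
      with card_F have "real N \<le> real (card ?F)" by simp
      moreover have "\<theta> * real N \<le> 1 * real N"
        using \<theta>_le by (intro mult_right_mono) auto
      ultimately show ?thesis by simp
    next
      case True
      \<comment> \<open>Up to \<open>N\<close>, all earlier blocks lie below \<open>\<eta> * n\<close>; only the block of the last time \<open>n\<close>
        has to be counted in full.\<close>
      define n where "n = Max {n \<in> S. n \<le> N}"
      have fin: "finite {n \<in> S. n \<le> N}" by simp
      have n: "n \<in> S" "n \<le> N" using Max_in[OF fin] True unfolding n_def by blast+
      have n_max: "n' \<le> n" if "n' \<in> S" "n' \<le> N" for n'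
        using Max_ge[OF fin] that by (auto simp: n_def)
      have "?B \<subseteq> {..<nat \<lceil>\<eta> * real n\<rceil>} \<union> {n..<min N (n + m n)}"
      proof
        fix i assume "i \<in> ?B"
        then obtain n' where i: "i < N" "in_block n' i" by blast
        then have n': "n' \<in> S" "n' \<le> i" "i < n' + m n'" by (auto simp: in_block_def)
        show "i \<in> {..<nat \<lceil>\<eta> * real n\<rceil>} \<union> {n..<min N (n + m n)}"
        proof (cases "n' = n")
          case True
          with n' i show ?thesis by auto
        next
          case False
          with n_max[of n'] n' i have "n' < n" by simp
          from gap[OF n'(1) n(1) this] n'(3) have "real i < \<eta> * real n" by linarith
          then show ?thesis by (simp add: less_ceiling_iff zless_nat_eq_int_zless)
        qed
      qed
      then have "card ?B \<le> card ({..<nat \<lceil>\<eta> * real n\<rceil>} \<union> {n..<min N (n + m n)})"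
        by (intro card_mono) auto
      also have "\<dots> \<le> nat \<lceil>\<eta> * real n\<rceil> + (min N (n + m n) - n)"
        using card_Un_le by (metis card_atLeastLessThan card_lessThan)
      finally have card_B: "card ?B \<le> nat \<lceil>\<eta> * real n\<rceil> + (min N (n + m n) - n)" .
      have ceil: "real (nat \<lceil>\<eta> * real n\<rceil>) \<le> \<eta> * real n + 1"
        using \<eta> by (simp add: of_nat_nat)
      have \<theta>_n: "\<theta> * (real n + real (m n)) \<le> (1 - \<eta>) * real n + 1"
      proof -
        have "\<theta> * (real n + real (m n)) \<le> \<theta> * ((1 + c) * real n + 1)"
          using m[of n] \<open>0 \<le> \<theta>\<close> by (intro mult_left_mono) (auto simp: algebra_simps)
        also have "\<theta> * ((1 + c) * real n + 1) \<le> (1 - \<eta>) * real n + 1"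
          using \<theta>_le by (simp add: \<eta>_def algebra_simps)
        finally show ?thesis .
      qed
      show ?thesis
      proof (cases "N \<le> n + m n")
        case True
        then have "\<theta> * real N \<le> \<theta> * (real n + real (m n))"
          using \<open>0 \<le> \<theta>\<close> by (intro mult_left_mono) auto
        moreover have "real N \<le> real (card ?F) + real (nat \<lceil>\<eta> * real n\<rceil>) + (real N - real n)"
          using card_F card_B True n by linarith
        ultimately show ?thesis using \<theta>_n ceil by (simp add: algebra_simps)
      next
        case False
        have "(1 - \<theta>) * (real n + real (m n)) \<le> (1 - \<theta>) * real N"
          using False \<theta>_le by (intro mult_left_mono) auto
        moreover have "real N \<le> real (card ?F) + real (nat \<lceil>\<eta> * real n\<rceil>) + real (m n)"
          using card_F card_B False by linarith
        ultimately show ?thesis using \<theta>_n ceil by (simp add: algebra_simps)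
      qed
    qed
  qed
  show thesis
  proof
    show "S \<subseteq> A" "infinite S" by (fact S)+
    show "\<forall>n\<in>S. \<forall>i<nat \<lceil>c * real n\<rceil>. src (n + i) = i"
    proof (intro ballI allI impI)
      fix n i assume "n \<in> S" "i < nat \<lceil>c * real n\<rceil>"
      then show "src (n + i) = i"
        using src_block[of n "n + i"] by (simp add: in_block_def m_def)
    qed
    show "\<forall>N. \<theta> * real N - 2 \<le> real (card {i. i < N \<and> \<not> src i < i})"
      using count by blast
  qed
qed

section \<open>Coding of the attractor\<close>

lemma left_shift_funpow: "(left_shift ^^ n) \<epsilon> = (\<lambda>i. \<epsilon> (n + i))"
  by (induction n) (auto simp: left_shift_def)

lemma left_shift_funpow_in:
  "\<epsilon> \<in> symbolic_space L \<Longrightarrow> (left_shift ^^ n) \<epsilon> \<in> symbolic_space L"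
  by (auto simp: left_shift_funpow symbolic_space_def)

lemma ex_first_difference:
  fixes f g :: "nat \<Rightarrow> 'a"
  assumes "f \<noteq> g"
  obtains N where "f N \<noteq> g N" "\<And>i. i < N \<Longrightarrow> f i = g i"
proof
  from assms have "\<exists>i. f i \<noteq> g i" by blast
  then show "f (LEAST i. f i \<noteq> g i) \<noteq> g (LEAST i. f i \<noteq> g i)" by (rule LeastI_ex)
  show "f i = g i" if "i < (LEAST i. f i \<noteq> g i)" for i
    using not_less_Least[OF that] by simp
qed

lemma ifs_comp_eq:
  "ifs_comp \<rho> a \<epsilon> n x = \<rho> ^ n * x + (\<Sum>i<n. \<rho> ^ i * a (\<epsilon> i))"
  by (induction n arbitrary: x) (auto simp: ifs_map_def algebra_simps)

text \<open>
  The images of the unit interval have diameter \<open>\<rho> ^ n\<close>, so their intersection has at most one point.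
\<close>
lemma coding_map_eqI:
  assumes "0 < \<rho>" "\<rho> < 1" and x: "\<And>n. x \<in> ifs_comp \<rho> a \<epsilon> n ` {0..1}"
  shows "coding_map \<rho> a \<epsilon> = x"
  unfolding coding_map_def
proof (rule the_equality)
  show "x \<in> (\<Inter>n\<in>{1..}. ifs_comp \<rho> a \<epsilon> n ` {0..1})" using x by blast
next
  fix y assume y: "y \<in> (\<Inter>n\<in>{1..}. ifs_comp \<rho> a \<epsilon> n ` {0..1})"
  have "\<bar>y - x\<bar> \<le> \<rho> ^ n" if "1 \<le> n" for n
  proof -
    from y that x[of n] obtain u v where u: "u \<in> {0..1}" "x = ifs_comp \<rho> a \<epsilon> n u"
      and v: "v \<in> {0..1}" "y = ifs_comp \<rho> a \<epsilon> n v" by blast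
    then have "y - x = \<rho> ^ n * (v - u)" by (simp add: ifs_comp_eq algebra_simps)
    moreover have "\<bar>v - u\<bar> \<le> 1" using u v by auto
    ultimately show ?thesis
      using \<open>0 < \<rho>\<close> mult_left_mono[of "\<bar>v - u\<bar>" 1 "\<rho> ^ n"] by (simp add: abs_mult)
  qed
  then have "\<bar>y - x\<bar> \<le> 0"
    using assms by (intro LIMSEQ_le_const[OF LIMSEQ_power_zero[of \<rho>]]) auto
  then show "y = x" by simp
qed

locale separated_ifs =
  fixes L :: nat and \<rho> :: real and a :: "nat \<Rightarrow> real" and K :: "real set"
  assumes ifs: "homogeneous_ifs L \<rho> a"
    and attractor: "is_attractor L \<rho> a K"
    and separation: "strong_separation L \<rho> a K"
begin

abbreviation T :: "real \<Rightarrow> real" where "T \<equiv> ifs_shift L \<rho> a"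
abbreviation code :: "(nat \<Rightarrow> nat) \<Rightarrow> real" where "code \<equiv> coding_map \<rho> a"

text \<open>
  The solution \<open>s\<close> of \<open>L * \<rho> powr s = 1\<close>.
\<close>
definition similarity_dim :: real where
  "similarity_dim = ln (real L) / (- ln \<rho>)"

lemma L_ge: "2 \<le> L" and rho: "0 < \<rho>" "\<rho> < 1"
  using ifs by (auto simp: homogeneous_ifs_def)

lemma similarity_dim_pos: "0 < similarity_dim"
  using L_ge rho by (auto simp: similarity_dim_def divide_pos_neg)

lemma real_L_eq: "real L = \<rho> powr (- similarity_dim)"
  using L_ge rho by (simp add: similarity_dim_def powr_def)

lemma translation_bounds:
  assumes "j \<in> {1..L}"
  shows "0 \<le> a j" "a j \<le> 1 - \<rho>"
proof -
  have mono: "strict_mono_on {1..L} a" and ends: "0 \<le> a 1" "a L \<le> 1 - \<rho>"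
    using ifs by (auto simp: homogeneous_ifs_def)
  have "a 1 \<le> a j" "a j \<le> a L"
    using assms by (auto intro!: strict_mono_on_leD[OF mono])
  with ends show "0 \<le> a j" "a j \<le> 1 - \<rho>" by auto
qed

lemma summable_code:
  assumes "\<epsilon> \<in> symbolic_space L"
  shows "summable (\<lambda>i. \<rho> ^ i * a (\<epsilon> i))" "(\<Sum>i. \<rho> ^ i * a (\<epsilon> i)) \<in> {0..1}"
proof -
  have bounds: "0 \<le> \<rho> ^ i * a (\<epsilon> i)" "\<rho> ^ i * a (\<epsilon> i) \<le> \<rho> ^ i * (1 - \<rho>)" for i
    using assms translation_bounds[of "\<epsilon> i"] rho
    by (auto simp: symbolic_space_def intro!: mult_left_mono)
  have geom: "(\<lambda>i. \<rho> ^ i * (1 - \<rho>)) sums 1"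
    using sums_mult2[OF geometric_sums[of \<rho>], of "1 - \<rho>"] rho by simp
  show summable: "summable (\<lambda>i. \<rho> ^ i * a (\<epsilon> i))"
    using bounds by (intro summable_comparison_test[OF _ sums_summable[OF geom]]) auto
  show "(\<Sum>i. \<rho> ^ i * a (\<epsilon> i)) \<in> {0..1}"
    using suminf_nonneg[OF summable] suminf_le[OF _ summable sums_summable[OF geom]] bounds
      sums_unique[OF geom] by auto
qed

lemma code_eq_suminf:
  assumes "\<epsilon> \<in> symbolic_space L"
  shows "code \<epsilon> = (\<Sum>i. \<rho> ^ i * a (\<epsilon> i))"
proof (rule coding_map_eqI[OF rho])
  fix n
  let ?u = "\<Sum>i. \<rho> ^ i * a ((left_shift ^^ n) \<epsilon> i)"
  note shift = left_shift_funpow_in[OF assms, of n]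
  have "(\<Sum>i. \<rho> ^ i * a (\<epsilon> i)) = \<rho> ^ n * ?u + (\<Sum>i<n. \<rho> ^ i * a (\<epsilon> i))"
    using suminf_split_initial_segment[OF summable_code(1)[OF assms], of n]
      suminf_mult[OF summable_code(1)[OF shift], of "\<rho> ^ n"]
    by (simp add: left_shift_funpow power_add mult_ac add.commute)
  then have "(\<Sum>i. \<rho> ^ i * a (\<epsilon> i)) = ifs_comp \<rho> a \<epsilon> n ?u"
    by (simp add: ifs_comp_eq)
  with summable_code(2)[OF shift] show "(\<Sum>i. \<rho> ^ i * a (\<epsilon> i)) \<in> ifs_comp \<rho> a \<epsilon> n ` {0..1}"
    by blast
qed

lemma code_in_unit: "\<epsilon> \<in> symbolic_space L \<Longrightarrow> code \<epsilon> \<in> {0..1}"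
  using summable_code(2) by (simp add: code_eq_suminf)

lemma code_split:
  assumes "\<epsilon> \<in> symbolic_space L"
  shows "code \<epsilon> = \<rho> ^ n * code ((left_shift ^^ n) \<epsilon>) + (\<Sum>i<n. \<rho> ^ i * a (\<epsilon> i))"
  using suminf_split_initial_segment[OF summable_code(1)[OF assms], of n]
    suminf_mult[OF summable_code(1)[OF left_shift_funpow_in[OF assms, of n]], of "\<rho> ^ n"]
    left_shift_funpow_in[OF assms, of n] assms
  by (simp add: code_eq_suminf left_shift_funpow power_add mult_ac add.commute)

lemma ifs_map_in: "j \<in> {1..L} \<Longrightarrow> x \<in> K \<Longrightarrow> ifs_map \<rho> a j x \<in> K"
  using attractor unfolding is_attractor_def by blast

lemma code_in_K:
  assumes "\<epsilon> \<in> symbolic_space L"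
  shows "code \<epsilon> \<in> K"
proof -
  obtain x where x: "x \<in> K" using attractor unfolding is_attractor_def by blast
  have "ifs_comp \<rho> a \<epsilon> n y \<in> K" if "y \<in> K" for n y
    using that
  proof (induction n arbitrary: y)
    case (Suc n)
    have "\<epsilon> n \<in> {1..L}" using assms by (auto simp: symbolic_space_def)
    with Suc ifs_map_in show ?case by simp
  qed simp
  moreover have "(\<lambda>n. ifs_comp \<rho> a \<epsilon> n x) \<longlonglongrightarrow> 0 * x + code \<epsilon>"
    unfolding ifs_comp_eq code_eq_suminf[OF assms] using rho
    by (intro tendsto_intros LIMSEQ_power_zero summable_LIMSEQ summable_code assms) auto
  moreover have "closed K"
    using attractor by (simp add: is_attractor_def compact_imp_closed)
  ultimately show ?thesis
    using x closed_sequentially[of K "\<lambda>n. ifs_comp \<rho> a \<epsilon> n x" "code \<epsilon>"] by simp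
qed

lemma code_surj:
  assumes "x \<in> K"
  obtains \<epsilon> where "\<epsilon> \<in> symbolic_space L" "code \<epsilon> = x"
proof -
  have "\<exists>j z. j \<in> {1..L} \<and> z \<in> K \<and> y = ifs_map \<rho> a j z" if "y \<in> K" for y
    using attractor that unfolding is_attractor_def by blast
  then obtain J Z where JZ: "\<And>y. y \<in> K \<Longrightarrow> J y \<in> {1..L}" "\<And>y. y \<in> K \<Longrightarrow> Z y \<in> K"
    "\<And>y. y \<in> K \<Longrightarrow> ifs_map \<rho> a (J y) (Z y) = y" by metis
  define \<epsilon> where "\<epsilon> n = J ((Z ^^ n) x)" for n
  have Z_in: "(Z ^^ n) x \<in> K" for n using assms JZ by (induction n) auto
  have "ifs_comp \<rho> a \<epsilon> n ((Z ^^ n) x) = x" for n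
    by (induction n) (simp_all add: \<epsilon>_def JZ Z_in)
  moreover have "(Z ^^ n) x \<in> {0..1}" for n
    using Z_in attractor unfolding is_attractor_def by blast
  ultimately have "code \<epsilon> = x" by (intro coding_map_eqI[OF rho]) (metis image_eqI)
  moreover have "\<epsilon> \<in> symbolic_space L" using JZ Z_in by (auto simp: \<epsilon>_def symbolic_space_def)
  ultimately show thesis using that by blast
qed

text \<open>
  Finitely many disjoint compact sets have positive mutual distances.
\<close>
lemma ex_gap:
  obtains \<kappa> where "0 < \<kappa>"
    "\<And>i j x y. i \<in> {1..L} \<Longrightarrow> j \<in> {1..L} \<Longrightarrow> i \<noteq> j \<Longrightarrow> x \<in> K \<Longrightarrow> y \<in> K \<Longrightarrow>
      \<kappa> \<le> \<bar>ifs_map \<rho> a i x - ifs_map \<rho> a j y\<bar>"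
proof -
  have cpt: "compact (ifs_map \<rho> a j ` K)" for j
    using attractor unfolding is_attractor_def ifs_map_def[abs_def]
    by (intro compact_continuous_image continuous_intros) auto
  have "\<exists>\<delta>>0. \<forall>j\<in>{1..L} - {i}. \<forall>x\<in>K. \<forall>y\<in>K. \<delta> \<le> dist (ifs_map \<rho> a i x) (ifs_map \<rho> a j y)"
    if "i \<in> {1..L}" for i
  proof -
    let ?R = "\<Union>j\<in>{1..L} - {i}. ifs_map \<rho> a j ` K"
    have "ifs_map \<rho> a i ` K \<inter> ?R = {}"
      using separation that unfolding strong_separation_def disjoint_family_on_def by blast
    moreover have "closed ?R" by (intro compact_imp_closed compact_UN cpt) auto
    ultimately have "\<exists>\<delta>>0. \<forall>x\<in>ifs_map \<rho> a i ` K. \<forall>y\<in>?R. \<delta> \<le> dist x y"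
      by (intro separate_compact_closed cpt)
    then obtain \<delta> where \<delta>: "0 < \<delta>" "\<forall>x\<in>ifs_map \<rho> a i ` K. \<forall>y\<in>?R. \<delta> \<le> dist x y"
      by (elim exE conjE)
    show ?thesis
    proof (intro exI conjI ballI)
      fix j x y assume "j \<in> {1..L} - {i}" "x \<in> K" "y \<in> K"
      then have "ifs_map \<rho> a i x \<in> ifs_map \<rho> a i ` K" "ifs_map \<rho> a j y \<in> ?R"
        by blast+
      with \<delta>(2) show "\<delta> \<le> dist (ifs_map \<rho> a i x) (ifs_map \<rho> a j y)" by (elim ballE) auto
    qed fact
  qed
  then obtain \<delta> where \<delta>: "\<And>i. i \<in> {1..L} \<Longrightarrow> 0 < \<delta> i"
    "\<And>i j x y. i \<in> {1..L} \<Longrightarrow> j \<in> {1..L} - {i} \<Longrightarrow> x \<in> K \<Longrightarrow> y \<in> K \<Longrightarrow>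
      \<delta> i \<le> dist (ifs_map \<rho> a i x) (ifs_map \<rho> a j y)"
    by metis
  have ne: "\<delta> ` {1..L} \<noteq> {}" using L_ge by auto
  show thesis
  proof
    show "0 < Min (\<delta> ` {1..L})" using \<delta>(1) ne by (subst Min_gr_iff) auto
    fix i j x y assume *: "i \<in> {1..L}" "j \<in> {1..L}" "i \<noteq> j" "x \<in> K" "y \<in> K"
    have "Min (\<delta> ` {1..L}) \<le> \<delta> i" using * by (intro Min_le) auto
    also have "\<dots> \<le> dist (ifs_map \<rho> a i x) (ifs_map \<rho> a j y)" using * by (intro \<delta>(2)) auto
    finally show "Min (\<delta> ` {1..L}) \<le> \<bar>ifs_map \<rho> a i x - ifs_map \<rho> a j y\<bar>"
      by (simp add: dist_real_def)
  qed
qed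

lemma code_diff:
  assumes "\<epsilon> \<in> symbolic_space L" "\<epsilon>' \<in> symbolic_space L" "\<And>i. i < N \<Longrightarrow> \<epsilon> i = \<epsilon>' i"
  shows "code \<epsilon> - code \<epsilon>' = \<rho> ^ N * (code ((left_shift ^^ N) \<epsilon>) - code ((left_shift ^^ N) \<epsilon>'))"
proof -
  have "(\<Sum>i<N. \<rho> ^ i * a (\<epsilon> i)) = (\<Sum>i<N. \<rho> ^ i * a (\<epsilon>' i))"
    using assms(3) by (intro sum.cong) auto
  then show ?thesis
    using code_split[OF assms(1), of N] code_split[OF assms(2), of N] by (simp add: algebra_simps)
qed

lemma code_close:
  assumes "\<epsilon> \<in> symbolic_space L" "\<epsilon>' \<in> symbolic_space L" "\<And>i. i < N \<Longrightarrow> \<epsilon> i = \<epsilon>' i"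
  shows "\<bar>code \<epsilon> - code \<epsilon>'\<bar> \<le> \<rho> ^ N"
proof -
  have "\<bar>code ((left_shift ^^ N) \<epsilon>) - code ((left_shift ^^ N) \<epsilon>')\<bar> \<le> 1"
    using code_in_unit[OF left_shift_funpow_in[OF assms(1), of N]]
      code_in_unit[OF left_shift_funpow_in[OF assms(2), of N]] by auto
  then have "\<rho> ^ N * \<bar>code ((left_shift ^^ N) \<epsilon>) - code ((left_shift ^^ N) \<epsilon>')\<bar> \<le> \<rho> ^ N * 1"
    using rho by (intro mult_left_mono) auto
  with rho show ?thesis by (simp add: code_diff[OF assms] abs_mult)
qed

text \<open>
  The only quantitative consequence of strong separation in the proof: after the common prefix of
  length \<open>N\<close>, the shifted points lie in different first-level pieces of the attractor, and the
  prefix contracts their distance by \<open>\<rho> ^ N\<close>.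
\<close>
lemma ex_code_separation:
  obtains \<kappa> where "0 < \<kappa>"
    "\<And>\<epsilon> \<epsilon>' N. \<epsilon> \<in> symbolic_space L \<Longrightarrow> \<epsilon>' \<in> symbolic_space L \<Longrightarrow> (\<And>i. i < N \<Longrightarrow> \<epsilon> i = \<epsilon>' i) \<Longrightarrow>
      \<epsilon> N \<noteq> \<epsilon>' N \<Longrightarrow> \<kappa> * \<rho> ^ N \<le> \<bar>code \<epsilon> - code \<epsilon>'\<bar>"
proof -
  obtain \<kappa> where \<kappa>: "0 < \<kappa>"
    "\<And>i j x y. i \<in> {1..L} \<Longrightarrow> j \<in> {1..L} \<Longrightarrow> i \<noteq> j \<Longrightarrow> x \<in> K \<Longrightarrow> y \<in> K \<Longrightarrow>
      \<kappa> \<le> \<bar>ifs_map \<rho> a i x - ifs_map \<rho> a j y\<bar>" by (rule ex_gap) blast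
  have head: "code ((left_shift ^^ N) \<epsilon>) = ifs_map \<rho> a (\<epsilon> N) (code ((left_shift ^^ Suc N) \<epsilon>))"
    if "\<epsilon> \<in> symbolic_space L" for \<epsilon> N
    using code_split[OF left_shift_funpow_in[OF that, of N], of 1]
    by (simp add: ifs_map_def left_shift_funpow left_shift_def)
  show thesis
  proof
    fix \<epsilon> \<epsilon>' N
    assume \<epsilon>: "\<epsilon> \<in> symbolic_space L" "\<epsilon>' \<in> symbolic_space L" "\<And>i. i < N \<Longrightarrow> \<epsilon> i = \<epsilon>' i"
      and ne: "\<epsilon> N \<noteq> \<epsilon>' N"
    have "\<kappa> \<le> \<bar>code ((left_shift ^^ N) \<epsilon>) - code ((left_shift ^^ N) \<epsilon>')\<bar>"
      unfolding head[OF \<epsilon>(1), of N] head[OF \<epsilon>(2), of N] using \<epsilon>(1,2) ne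
      by (intro \<kappa>(2) code_in_K left_shift_funpow_in) (auto simp: symbolic_space_def)
    then have "\<rho> ^ N * \<kappa> \<le> \<rho> ^ N * \<bar>code ((left_shift ^^ N) \<epsilon>) - code ((left_shift ^^ N) \<epsilon>')\<bar>"
      using rho by (intro mult_left_mono) auto
    with rho show "\<kappa> * \<rho> ^ N \<le> \<bar>code \<epsilon> - code \<epsilon>'\<bar>"
      by (simp add: code_diff[OF \<epsilon>] abs_mult mult.commute)
  qed fact
qed

lemma coding_code:
  assumes "\<epsilon> \<in> symbolic_space L"
  shows "coding L \<rho> a (code \<epsilon>) = \<epsilon>"
  unfolding coding_def
proof (rule the_equality)
  fix \<epsilon>' assume \<epsilon>': "\<epsilon>' \<in> symbolic_space L \<and> code \<epsilon>' = code \<epsilon>"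
  show "\<epsilon>' = \<epsilon>"
  proof (rule ccontr)
    assume "\<epsilon>' \<noteq> \<epsilon>"
    then obtain N where N: "\<epsilon>' N \<noteq> \<epsilon> N" "\<And>i. i < N \<Longrightarrow> \<epsilon>' i = \<epsilon> i"
      by (rule ex_first_difference) blast
    obtain \<kappa> where "0 < \<kappa>"
      "\<And>\<epsilon> \<epsilon>' N. \<epsilon> \<in> symbolic_space L \<Longrightarrow> \<epsilon>' \<in> symbolic_space L \<Longrightarrow> (\<And>i. i < N \<Longrightarrow> \<epsilon> i = \<epsilon>' i) \<Longrightarrow>
        \<epsilon> N \<noteq> \<epsilon>' N \<Longrightarrow> \<kappa> * \<rho> ^ N \<le> \<bar>code \<epsilon> - code \<epsilon>'\<bar>"
      by (rule ex_code_separation) blast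
    note \<kappa> = this
    have "\<kappa> * \<rho> ^ N \<le> \<bar>code \<epsilon>' - code \<epsilon>\<bar>"
      using \<epsilon>' assms N by (intro \<kappa>(2)) auto
    moreover have "0 < \<kappa> * \<rho> ^ N" using \<kappa>(1) rho by simp
    ultimately show False using \<epsilon>' by simp
  qed
qed (use assms in simp)

lemma T_funpow_code:
  assumes "\<epsilon> \<in> symbolic_space L"
  shows "(T ^^ n) (code \<epsilon>) = code ((left_shift ^^ n) \<epsilon>)"
  by (induction n) (simp_all add: ifs_shift_def coding_code left_shift_funpow_in assms)

lemma T_funpow_in_K: "x \<in> K \<Longrightarrow> (T ^^ n) x \<in> K"
  by (metis T_funpow_code code_in_K code_surj left_shift_funpow_in)

lemma dist_T_funpow_le:
  assumes "x \<in> K"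
  shows "\<bar>(T ^^ n) x - x\<bar> \<le> 1"
proof -
  have "x \<in> {0..1}" "(T ^^ n) x \<in> {0..1}"
    using assms T_funpow_in_K[OF assms] attractor unfolding is_attractor_def by blast+
  then show ?thesis by auto
qed

text \<open>
  The inverse branches of \<open>T ^^ n\<close> are the compositions of \<open>n\<close> of the similarities. They all have
  slope \<open>\<rho> ^ n\<close>, so that a branch can be represented by its translation part \<open>p\<close>.
\<close>
lemma ex_inverse_branches:
  obtains P where "finite P" "card P \<le> L ^ n" "\<And>x. x \<in> K \<Longrightarrow> \<exists>p\<in>P. x = \<rho> ^ n * (T ^^ n) x + p"
proof
  let ?W = "{..<n} \<rightarrow>\<^sub>E {1..L}" and ?h = "\<lambda>w. \<Sum>i<n. \<rho> ^ i * a (w i)"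
  have fin: "finite ?W" by (intro finite_PiE) auto
  then show "finite (?h ` ?W)" by simp
  show "card (?h ` ?W) \<le> L ^ n"
    using card_image_le[OF fin, of ?h] by (simp add: card_PiE)
  fix x assume "x \<in> K"
  then obtain \<epsilon> where \<epsilon>: "\<epsilon> \<in> symbolic_space L" "code \<epsilon> = x" by (rule code_surj)
  show "\<exists>p\<in>?h ` ?W. x = \<rho> ^ n * (T ^^ n) x + p"
  proof (intro bexI)
    have "?h \<epsilon> = ?h (restrict \<epsilon> {..<n})" by (intro sum.cong) auto
    moreover have "restrict \<epsilon> {..<n} \<in> ?W" using \<epsilon> by (auto simp: symbolic_space_def)
    ultimately show "?h \<epsilon> \<in> ?h ` ?W" by (rule image_eqI)
    show "x = \<rho> ^ n * (T ^^ n) x + ?h \<epsilon>"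
      using code_split[OF \<epsilon>(1), of n] T_funpow_code[OF \<epsilon>(1)] \<epsilon>(2) by simp
  qed
qed

section \<open>Upper bound\<close>

text \<open>
  If \<open>x\<close> and \<open>y\<close> are in the image of the same inverse branch and both are within \<open>q\<close> of their \<open>n\<close>-th
  iterate, then \<open>\<bar>x - y\<bar> = \<rho> ^ n * \<bar>(T ^^ n) x - (T ^^ n) y\<bar> \<le> \<rho> ^ n * (\<bar>x - y\<bar> + 2 * q)\<close>. For
  \<open>n \<ge> 1\<close> the term with \<open>\<bar>x - y\<bar>\<close> can be absorbed into the left side, which gives
  \<open>\<bar>x - y\<bar> \<le> 2 / (1 - \<rho>) * \<rho> ^ n * q\<close>. Here \<open>q = \<rho> powr (c * n)\<close>.
\<close>
lemma hausdorff_measure_recurrent_eq_0: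
  assumes "0 \<le> c" and s: "similarity_dim / (1 + c) < s"
  shows "hausdorff_measure s
    {x \<in> K. infinite {n. 1 \<le> n \<and> \<bar>(T ^^ n) x - x\<bar> \<le> \<rho> powr (c * real n)}} = 0"
    (is "hausdorff_measure s ?A = 0")
proof -
  have "0 < similarity_dim / (1 + c)" using similarity_dim_pos \<open>0 \<le> c\<close> by simp
  with s have "0 < s" by linarith
  have "\<exists>P. finite P \<and> card P \<le> L ^ n \<and> (\<forall>x\<in>K. \<exists>p\<in>P. x = \<rho> ^ n * (T ^^ n) x + p)" for n
    using ex_inverse_branches[of n] by metis
  then obtain P where P: "\<And>n. finite (P n)" "\<And>n. card (P n) \<le> L ^ n"
    "\<And>n x. x \<in> K \<Longrightarrow> \<exists>p\<in>P n. x = \<rho> ^ n * (T ^^ n) x + p" by metis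
  define U where "U n p = {x \<in> K. 1 \<le> n \<and> x = \<rho> ^ n * (T ^^ n) x + p \<and>
    \<bar>(T ^^ n) x - x\<bar> \<le> \<rho> powr (c * real n)}" for n p
  define C where "C = 2 / (1 - \<rho>)"
  define r where "r n = C * \<rho> powr ((1 + c) * real n)" for n
  have "0 < C" using rho by (simp add: C_def)
  have U_diam: "\<bar>x - y\<bar> \<le> r n" if xy: "x \<in> U n p" "y \<in> U n p" for n p x y
  proof -
    define q where "q = \<rho> powr (c * real n)"
    from xy have n: "1 \<le> n" by (simp add: U_def)
    from xy have "x - y = \<rho> ^ n * ((T ^^ n) x - (T ^^ n) y)"
      unfolding U_def by (auto simp: algebra_simps)
    then have eq: "\<bar>x - y\<bar> = \<rho> ^ n * \<bar>(T ^^ n) x - (T ^^ n) y\<bar>"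
      using rho by (simp add: abs_mult)
    have "\<bar>(T ^^ n) x - (T ^^ n) y\<bar> \<le> \<bar>x - y\<bar> + 2 * q"
      using xy unfolding U_def q_def by (auto simp: abs_le_iff)
    then have "\<rho> ^ n * \<bar>(T ^^ n) x - (T ^^ n) y\<bar> \<le> \<rho> ^ n * (\<bar>x - y\<bar> + 2 * q)"
      using rho by (intro mult_left_mono) auto
    with eq have "\<bar>x - y\<bar> \<le> \<rho> ^ n * \<bar>x - y\<bar> + 2 * (\<rho> ^ n * q)"
      by (simp add: algebra_simps)
    also have "\<rho> ^ n * \<bar>x - y\<bar> \<le> \<rho> * \<bar>x - y\<bar>"
      using power_decreasing[OF n, of \<rho>] rho by (intro mult_right_mono) auto
    finally have "(1 - \<rho>) * \<bar>x - y\<bar> \<le> 2 * (\<rho> ^ n * q)" by (simp add: algebra_simps)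
    moreover have "\<rho> ^ n * q = \<rho> powr ((1 + c) * real n)"
      using rho by (simp add: q_def powr_realpow[symmetric] powr_add[symmetric] algebra_simps)
    ultimately show ?thesis using rho by (simp add: r_def C_def field_simps)
  qed
  have ratio: "real L * \<rho> powr ((1 + c) * s) < 1" "\<rho> powr (1 + c) < 1"
  proof -
    have "similarity_dim < (1 + c) * s" using s \<open>0 \<le> c\<close> by (simp add: field_simps)
    then have "\<rho> powr ((1 + c) * s - similarity_dim) < \<rho> powr 0"
      using rho by (intro powr_less_mono') auto
    then show "real L * \<rho> powr ((1 + c) * s) < 1"
      using rho by (simp add: real_L_eq powr_add[symmetric])
    show "\<rho> powr (1 + c) < 1"
      using powr_less_mono'[of \<rho> 0 "1 + c"] rho \<open>0 \<le> c\<close> by simp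
  qed
  have r_eq: "r n = C * (\<rho> powr (1 + c)) ^ n" for n
    using rho by (simp add: r_def powr_powr[symmetric] powr_realpow)
  show ?thesis
  proof (rule hausdorff_measure_limsup_eq_0[where \<U> = "\<lambda>n. U n ` P n" and M = "\<lambda>n. L ^ n" and r = r])
    show "0 < s" by fact
    show "finite (U n ` P n)" "card (U n ` P n) \<le> L ^ n" for n
      using P(1,2)[of n] card_image_le[OF P(1), of "U n" n] by auto
    show "bounded V" if "V \<in> U n ` P n" for n V
    proof (rule bounded_subset)
      show "bounded K" using attractor by (simp add: is_attractor_def compact_imp_bounded)
      show "V \<subseteq> K" using that by (auto simp: U_def)
    qed
    show nonneg: "0 \<le> r n" for n using \<open>0 < C\<close> by (simp add: r_def)
    show "diameter V \<le> r n" if "V \<in> U n ` P n" for n V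
      using that U_diam nonneg by (intro diameter_le) auto
    show "r \<longlonglongrightarrow> 0"
      unfolding r_eq[abs_def] using ratio(2) rho
      by (intro tendsto_mult_right_zero LIMSEQ_power_zero) auto
    have "real (L ^ n) * r n powr s = C powr s * (real L * \<rho> powr ((1 + c) * s)) ^ n" for n
      using rho \<open>0 < C\<close>
      by (simp add: r_def powr_mult powr_powr power_mult_distrib powr_realpow[symmetric] mult_ac)
    then show "summable (\<lambda>n. real (L ^ n) * r n powr s)"
      using ratio(1) by (auto intro!: summable_mult summable_geometric simp: abs_mult)
    fix x assume x: "x \<in> ?A"
    have "{n. 1 \<le> n \<and> \<bar>(T ^^ n) x - x\<bar> \<le> \<rho> powr (c * real n)} \<subseteq> {n. x \<in> \<Union>(U n ` P n)}"
      using x P(3)[of x] by (fastforce simp: U_def)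
    with x show "infinite {n. x \<in> \<Union>(U n ` P n)}" using infinite_super by blast
  qed
qed

section \<open>Lower bound\<close>

text \<open>
  The points with codings \<open>copy_fill src (digit L t)\<close>, \<open>t \<in> [0, 1)\<close>, return close to themselves at
  all times of \<open>S\<close>. If two of these codings first differ at \<open>N\<close>, the points are at least
  \<open>\<kappa> * \<rho> ^ N\<close> apart, while the parameters share at least \<open>\<theta> * N - 2\<close> digits and are at
  most \<open>L powr (2 - \<theta> * N)\<close> apart. Since \<open>L = \<rho> powr (- similarity_dim)\<close>, this is Hoelder continuity
  of the parameter, of exponent \<open>u\<close> whenever \<open>u \<le> similarity_dim * \<theta>\<close>.
\<close>
lemma hausdorff_measure_recurrence_set_nonzero:
  assumes "0 \<le> c" and \<phi>: "infinite {n. 1 \<le> n \<and> \<rho> powr (c * real n) < \<phi> n}"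
    and u: "0 \<le> u" "u < similarity_dim / (1 + c)"
  shows "hausdorff_measure u (recurrence_set K T \<phi>) \<noteq> 0"
proof -
  let ?A = "{n. 1 \<le> n \<and> \<rho> powr (c * real n) < \<phi> n}"
  have "u / similarity_dim < 1 / (1 + c)"
    using u by (simp add: pos_divide_less_eq[OF similarity_dim_pos])
  \<comment> \<open>The strict inequality on the left keeps \<open>\<theta>\<close> positive also for \<open>u = 0\<close>; otherwise there
    might be only finitely many free positions.\<close>
  then obtain \<theta> where \<theta>: "u / similarity_dim < \<theta>" "\<theta> < 1 / (1 + c)"
    using dense by blast
  have "0 \<le> u / similarity_dim" using u similarity_dim_pos by simp
  with \<theta> have "0 < \<theta>" by linarith
  have "\<theta> * (1 + c) < 1" using \<theta>(2) \<open>0 \<le> c\<close> by (simp add: pos_less_divide_eq)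
  have "0 \<notin> ?A" "0 \<le> \<theta>" using \<open>0 < \<theta>\<close> by simp_all
  obtain S src where S: "S \<subseteq> ?A" "infinite S"
    and src: "\<forall>n\<in>S. \<forall>i<nat \<lceil>c * real n\<rceil>. src (n + i) = i"
    and count: "\<forall>N. \<theta> * real N - 2 \<le> real (card {i. i < N \<and> \<not> src i < i})"
    by (rule ex_copying_scheme[OF \<phi> \<open>0 \<notin> ?A\<close> \<open>0 \<le> c\<close> \<open>0 \<le> \<theta>\<close> \<open>\<theta> * (1 + c) < 1\<close>]) (rule that)
  define \<epsilon> where "\<epsilon> t = copy_fill src (digit L t)" for t
  have \<epsilon>_in: "\<epsilon> t \<in> symbolic_space L" for t
    using copy_fill_in[of "digit L t" "{1..L}"] digit_in[of L t] L_ge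
    by (auto simp: symbolic_space_def \<epsilon>_def)
  have recurrent: "code (\<epsilon> t) \<in> recurrence_set K T \<phi>" for t
  proof -
    have "\<bar>(T ^^ n) (code (\<epsilon> t)) - code (\<epsilon> t)\<bar> < \<phi> n" if "n \<in> S" for n
    proof -
      from that S have n: "1 \<le> n" "\<rho> powr (c * real n) < \<phi> n" by auto
      have "(left_shift ^^ n) (\<epsilon> t) i = \<epsilon> t i" if "i < nat \<lceil>c * real n\<rceil>" for i
        using src \<open>n \<in> S\<close> that n by (simp add: left_shift_funpow \<epsilon>_def copy_fill.simps[of src _ "n + i"])
      then have "\<bar>(T ^^ n) (code (\<epsilon> t)) - code (\<epsilon> t)\<bar> \<le> \<rho> ^ nat \<lceil>c * real n\<rceil>"
        unfolding T_funpow_code[OF \<epsilon>_in] by (intro code_close left_shift_funpow_in \<epsilon>_in) auto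
      also have "\<dots> = \<rho> powr real (nat \<lceil>c * real n\<rceil>)" using rho by (simp add: powr_realpow)
      also have "\<dots> \<le> \<rho> powr (c * real n)"
        using rho by (intro powr_mono' real_nat_ceiling_ge) auto
      also note n(2)
      finally show ?thesis .
    qed
    then have "S \<subseteq> {n. 1 \<le> n \<and> \<bar>(T ^^ n) (code (\<epsilon> t)) - code (\<epsilon> t)\<bar> < \<phi> n}"
      using S by blast
    then show ?thesis
      using S(2) code_in_K[OF \<epsilon>_in] infinite_super unfolding recurrence_set_def by blast
  qed
  obtain \<kappa> where \<kappa>: "0 < \<kappa>"
    "\<And>\<epsilon> \<epsilon>' N. \<epsilon> \<in> symbolic_space L \<Longrightarrow> \<epsilon>' \<in> symbolic_space L \<Longrightarrow> (\<And>i. i < N \<Longrightarrow> \<epsilon> i = \<epsilon>' i) \<Longrightarrow>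
      \<epsilon> N \<noteq> \<epsilon>' N \<Longrightarrow> \<kappa> * \<rho> ^ N \<le> \<bar>code \<epsilon> - code \<epsilon>'\<bar>"
    by (rule ex_code_separation) blast
  define C where "C = real L ^ 2 * (1 / \<kappa>) powr u"
  show ?thesis
  proof (rule hausdorff_measure_nonzero_of_Hoelder_inverse[of u C "\<lambda>t. code (\<epsilon> t)"])
    show "0 \<le> u" by fact
    show "0 < C" using L_ge \<kappa> by (simp add: C_def)
    show "(\<lambda>t. code (\<epsilon> t)) ` {0..<1} \<subseteq> recurrence_set K T \<phi>" using recurrent by blast
    fix t t' :: real assume t: "t \<in> {0..<1}" "t' \<in> {0..<1}"
    have prefix: "\<bar>t - t'\<bar> \<le> 1 / real L ^ card {i. i < N \<and> \<not> src i < i}"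
      if "\<And>i. i < N \<Longrightarrow> \<epsilon> t i = \<epsilon> t' i" for N
    proof (rule dist_le_of_digits_eq[OF L_ge t])
      fix j assume "j < card {i. i < N \<and> \<not> src i < i}"
      with that show "digit L t j = digit L t' j"
        unfolding \<epsilon>_def
        by (rule copy_fill_prefix_determines[where d = "digit L t" and d' = "digit L t'"])
    qed
    show "\<bar>t - t'\<bar> \<le> C * dist (code (\<epsilon> t)) (code (\<epsilon> t')) powr u"
    proof (cases "\<epsilon> t = \<epsilon> t'")
      case True
      have "\<bar>t - t'\<bar> \<le> (1 / real L) ^ k" for k
      proof -
        obtain N :: nat where "(real k + 2) / \<theta> \<le> real N" using real_arch_simple by blast
        then have "real k \<le> \<theta> * real N - 2" using \<open>0 < \<theta>\<close> by (simp add: field_simps)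
        with spec[OF count, of N] have k: "k \<le> card {i. i < N \<and> \<not> src i < i}" by linarith
        have "\<bar>t - t'\<bar> \<le> (1 / real L) ^ card {i. i < N \<and> \<not> src i < i}"
          using prefix[of N] True by (simp add: power_one_over)
        also have "\<dots> \<le> (1 / real L) ^ k" using k L_ge by (intro power_decreasing) auto
        finally show ?thesis .
      qed
      then have "\<bar>t - t'\<bar> \<le> 0"
        using L_ge by (intro LIMSEQ_le_const[OF LIMSEQ_power_zero[of "1 / real L"]]) auto
      with \<open>0 < C\<close> show ?thesis by simp
    next
      case False
      then obtain N where N: "\<epsilon> t N \<noteq> \<epsilon> t' N" and eq: "\<And>i. i < N \<Longrightarrow> \<epsilon> t i = \<epsilon> t' i"
        by (rule ex_first_difference) blast
      have "\<bar>t - t'\<bar> \<le> 1 / real L ^ card {i. i < N \<and> \<not> src i < i}"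
        using eq by (rule prefix)
      also have "\<dots> = real L powr (- real (card {i. i < N \<and> \<not> src i < i}))"
        using L_ge by (simp add: powr_minus powr_realpow field_simps)
      also have "\<dots> \<le> real L powr (2 - \<theta> * real N)"
        using L_ge spec[OF count, of N] by (intro powr_mono) auto
      also have "\<dots> = real L ^ 2 * \<rho> powr (similarity_dim * \<theta> * real N)"
      proof -
        have "real L powr (- (\<theta> * real N)) = \<rho> powr (similarity_dim * \<theta> * real N)"
          unfolding real_L_eq by (simp add: powr_powr mult_ac)
        moreover have "real L powr (2 - \<theta> * real N) = real L powr 2 * real L powr (- (\<theta> * real N))"
          using powr_add[of "real L" 2 "- (\<theta> * real N)"] by simp
        ultimately show ?thesis using L_ge by simp
      qed
      also have "\<dots> \<le> real L ^ 2 * (\<rho> ^ N) powr u"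
      proof -
        have "u \<le> similarity_dim * \<theta>" using \<theta>(1) similarity_dim_pos by (simp add: field_simps)
        then have "u * real N \<le> similarity_dim * \<theta> * real N" by (intro mult_right_mono) auto
        then have "\<rho> powr (similarity_dim * \<theta> * real N) \<le> \<rho> powr (u * real N)"
          using rho by (intro powr_mono') auto
        also have "\<dots> = (\<rho> ^ N) powr u"
          using rho by (simp add: powr_realpow[symmetric] powr_powr mult.commute)
        finally show ?thesis by (intro mult_left_mono) auto
      qed
      also have "\<dots> \<le> real L ^ 2 * ((1 / \<kappa>) * dist (code (\<epsilon> t)) (code (\<epsilon> t'))) powr u"
      proof (intro mult_left_mono powr_mono2)
        show "\<rho> ^ N \<le> (1 / \<kappa>) * dist (code (\<epsilon> t)) (code (\<epsilon> t'))"
          using \<kappa>(2)[OF \<epsilon>_in \<epsilon>_in eq N] \<kappa>(1) by (simp add: dist_real_def field_simps)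
      qed (use u rho in auto)
      also have "\<dots> = C * dist (code (\<epsilon> t)) (code (\<epsilon> t')) powr u"
        using \<kappa>(1) powr_mult[of "1 / \<kappa>" "dist (code (\<epsilon> t)) (code (\<epsilon> t'))" u]
        by (simp add: C_def)
      finally show ?thesis .
    qed
  qed
qed

section \<open>The dimensions of the attractor and of the recurrence set\<close>

text \<open>
  For \<open>c = 0\<close> the return condition is \<open>\<bar>(T ^^ n) x - x\<bar> \<le> 1\<close>, which holds at every point of \<open>K\<close>.
\<close>
lemma hausdorff_measure_attractor_eq_0:
  assumes "similarity_dim < s"
  shows "hausdorff_measure s K = 0"
proof -
  have "K \<subseteq> {x \<in> K. infinite {n. 1 \<le> n \<and> \<bar>(T ^^ n) x - x\<bar> \<le> \<rho> powr (0 * real n)}}"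
    using dist_T_funpow_le rho infinite_Ici[of "1::nat"] by (auto simp: atLeast_def)
  from hausdorff_measure_mono[OF this, of s] show ?thesis
    using hausdorff_measure_recurrent_eq_0[of 0 s] assms by simp
qed

lemma hausdorff_dim_attractor: "hausdorff_dim K = ereal similarity_dim"
proof (rule antisym)
  show "hausdorff_dim K \<le> ereal similarity_dim"
    using hausdorff_measure_attractor_eq_0 similarity_dim_pos by (intro hausdorff_dim_le) auto
  have "hausdorff_measure u K \<noteq> 0" if "0 \<le> u" "u < similarity_dim" for u
  proof -
    \<comment> \<open>With radius \<open>2\<close> the recurrence set is the whole attractor; any constant above \<open>1\<close> would do.\<close>
    have "infinite {n. 1 \<le> n \<and> \<rho> powr (0 * real n) < (2 :: real)}"
      using rho infinite_Ici[of "1::nat"] by (simp add: atLeast_def)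
    with that have "hausdorff_measure u (recurrence_set K T (\<lambda>_. 2)) \<noteq> 0"
      by (intro hausdorff_measure_recurrence_set_nonzero[of 0]) auto
    moreover have "recurrence_set K T (\<lambda>_. 2) \<subseteq> K" by (auto simp: recurrence_set_def)
    ultimately show ?thesis using hausdorff_measure_mono by (metis le_zero_eq)
  qed
  then show "ereal similarity_dim \<le> hausdorff_dim K" by (intro hausdorff_dim_ge) auto
qed

text \<open>
  For \<open>s > \<gamma> / (1 + b)\<close> and \<open>b > 0\<close> there is \<open>c\<close> strictly between \<open>\<gamma> / s - 1\<close> and \<open>b\<close>, and then
  \<open>\<phi> n \<le> \<rho> powr (c * n)\<close> for all large \<open>n\<close>. This covers \<open>b = \<infinity>\<close> too, with \<open>\<gamma> / (1 + b) = 0\<close>. For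
  \<open>b = 0\<close> the whole attractor is small enough.
\<close>
lemma hausdorff_dim_recurrence_set_le:
  assumes pos: "\<And>n. 1 \<le> n \<Longrightarrow> 0 < \<phi> n"
    and b: "b = liminf (\<lambda>n. ereal (log \<rho> (\<phi> n) / real n))" and "0 \<le> b"
  shows "hausdorff_dim (recurrence_set K T \<phi>) \<le> ereal similarity_dim / (1 + b)"
proof (rule hausdorff_dim_le)
  show nonneg: "0 \<le> ereal similarity_dim / (1 + b)"
    using \<open>0 \<le> b\<close> similarity_dim_pos by (cases b) auto
  fix s :: real assume "0 \<le> s" and s: "ereal similarity_dim / (1 + b) < ereal s"
  show "hausdorff_measure s (recurrence_set K T \<phi>) = 0"
  proof (cases "b = 0")
    case True
    have "recurrence_set K T \<phi> \<subseteq> K" by (auto simp: recurrence_set_def)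
    from hausdorff_measure_mono[OF this, of s] show ?thesis
      using hausdorff_measure_attractor_eq_0[of s] s True by (simp add: one_ereal_def)
  next
    case False
    have "0 < s" using le_less_trans[OF nonneg s] by simp
    define q where "q = max 0 (similarity_dim / s - 1)"
    have "ereal q < b"
    proof (cases b)
      case (real r)
      with s False \<open>0 \<le> b\<close> \<open>0 < s\<close> show ?thesis by (auto simp: q_def field_simps)
    qed (use \<open>0 \<le> b\<close> in auto)
    then obtain c where c: "ereal q < ereal c" "ereal c < b"
      using ereal_dense2 by blast
    then have "0 < c" "similarity_dim / s - 1 < c" by (auto simp: q_def)
    then have "similarity_dim / (1 + c) < s" using \<open>0 < s\<close> by (simp add: field_simps)
    have "eventually (\<lambda>n. ereal c < ereal (log \<rho> (\<phi> n) / real n)) sequentially"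
      using c(2) unfolding b by (rule less_LiminfD)
    then obtain N where N: "\<And>n. n \<ge> N \<Longrightarrow> c < log \<rho> (\<phi> n) / real n"
      by (auto simp: eventually_sequentially)
    have small: "\<phi> n \<le> \<rho> powr (c * real n)" if "n \<ge> max N 1" for n
    proof -
      have "c * real n \<le> log \<rho> (\<phi> n)" using N[of n] that by (simp add: field_simps)
      then have "\<rho> powr (log \<rho> (\<phi> n)) \<le> \<rho> powr (c * real n)"
        using rho by (intro powr_mono') auto
      with rho pos[of n] that show ?thesis by simp
    qed
    have "recurrence_set K T \<phi> \<subseteq>
        {x \<in> K. infinite {n. 1 \<le> n \<and> \<bar>(T ^^ n) x - x\<bar> \<le> \<rho> powr (c * real n)}}"
    proof
      fix x assume x: "x \<in> recurrence_set K T \<phi>"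
      then have "infinite ({n. 1 \<le> n \<and> \<bar>(T ^^ n) x - x\<bar> < \<phi> n} - {..<max N 1})"
        by (auto simp: recurrence_set_def)
      moreover have "{n. 1 \<le> n \<and> \<bar>(T ^^ n) x - x\<bar> < \<phi> n} - {..<max N 1} \<subseteq>
          {n. 1 \<le> n \<and> \<bar>(T ^^ n) x - x\<bar> \<le> \<rho> powr (c * real n)}"
      proof
        fix n assume n: "n \<in> {n. 1 \<le> n \<and> \<bar>(T ^^ n) x - x\<bar> < \<phi> n} - {..<max N 1}"
        then have "\<phi> n \<le> \<rho> powr (c * real n)" by (intro small) auto
        with n show "n \<in> {n. 1 \<le> n \<and> \<bar>(T ^^ n) x - x\<bar> \<le> \<rho> powr (c * real n)}" by auto
      qed
      ultimately have "infinite {n. 1 \<le> n \<and> \<bar>(T ^^ n) x - x\<bar> \<le> \<rho> powr (c * real n)}"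
        using infinite_super by blast
      with x show "x \<in> {x \<in> K. infinite {n. 1 \<le> n \<and> \<bar>(T ^^ n) x - x\<bar> \<le> \<rho> powr (c * real n)}}"
        by (simp add: recurrence_set_def)
    qed
    from hausdorff_measure_mono[OF this, of s] show ?thesis
      using hausdorff_measure_recurrent_eq_0[of c s] \<open>0 < c\<close> \<open>similarity_dim / (1 + c) < s\<close> by simp
  qed
qed

text \<open>
  For \<open>0 \<le> u < \<gamma> / (1 + b)\<close>, which forces \<open>b\<close> to be finite, there is \<open>c > b\<close> with
  \<open>u < \<gamma> / (1 + c)\<close>, and \<open>\<phi> n > \<rho> powr (c * n)\<close> for infinitely many \<open>n\<close>.
\<close>
lemma hausdorff_dim_recurrence_set_ge:
  assumes pos: "\<And>n. 1 \<le> n \<Longrightarrow> 0 < \<phi> n"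
    and b: "b = liminf (\<lambda>n. ereal (log \<rho> (\<phi> n) / real n))" and "0 \<le> b"
  shows "ereal similarity_dim / (1 + b) \<le> hausdorff_dim (recurrence_set K T \<phi>)"
proof (rule hausdorff_dim_ge)
  fix u :: real assume "0 \<le> u" and u: "ereal u < ereal similarity_dim / (1 + b)"
  obtain \<beta> where \<beta>: "b = ereal \<beta>" "0 \<le> \<beta>"
    using u \<open>0 \<le> u\<close> \<open>0 \<le> b\<close> by (cases b) auto
  with u have "u < similarity_dim / (1 + \<beta>)" by (simp add: one_ereal_def)
  have "\<exists>c>\<beta>. u < similarity_dim / (1 + c)"
  proof (cases "u = 0")
    case True
    with \<beta> similarity_dim_pos show ?thesis by (intro exI[of _ "\<beta> + 1"]) auto
  next
    case False
    with \<open>0 \<le> u\<close> \<beta> \<open>u < similarity_dim / (1 + \<beta>)\<close> have "\<beta> < similarity_dim / u - 1"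
      by (simp add: field_simps)
    then obtain c where "\<beta> < c" "c < similarity_dim / u - 1" using dense by blast
    with False \<open>0 \<le> u\<close> \<beta> show ?thesis by (intro exI[of _ c]) (auto simp: field_simps)
  qed
  then obtain c where c: "\<beta> < c" "u < similarity_dim / (1 + c)" by blast
  have "infinite {n. 1 \<le> n \<and> \<rho> powr (c * real n) < \<phi> n}"
  proof
    assume "finite {n. 1 \<le> n \<and> \<rho> powr (c * real n) < \<phi> n}"
    then obtain N where N: "\<And>n. 1 \<le> n \<Longrightarrow> \<rho> powr (c * real n) < \<phi> n \<Longrightarrow> n \<le> N"
      unfolding finite_nat_set_iff_bounded_le by blast
    have "c \<le> log \<rho> (\<phi> n) / real n" if "n \<ge> Suc N" for n
    proof -
      have n: "1 \<le> n" "\<phi> n \<le> \<rho> powr (c * real n)" using N[of n] that by force+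
      have "\<rho> powr (log \<rho> (\<phi> n)) \<le> \<rho> powr (c * real n)"
        using n rho pos[of n] by simp
      then have "c * real n \<le> log \<rho> (\<phi> n)"
        using rho powr_less_mono'[of \<rho> "log \<rho> (\<phi> n)" "c * real n"] by fastforce
      with n show ?thesis by (simp add: field_simps)
    qed
    then have "ereal c \<le> b"
      unfolding b by (intro Liminf_bounded) (auto simp: eventually_sequentially)
    with \<beta> c show False by simp
  qed
  with c \<beta> \<open>0 \<le> u\<close> show "hausdorff_measure u (recurrence_set K T \<phi>) \<noteq> 0"
    by (intro hausdorff_measure_recurrence_set_nonzero) auto
qed

end

theorem corollary1p8:
  fixes L :: nat and \<rho> \<gamma> :: real and a :: "nat \<Rightarrow> real" and K :: "real set"
    and \<phi> :: "nat \<Rightarrow> real" and b :: ereal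
  assumes ifs: "homogeneous_ifs L \<rho> a"
    and attractor: "is_attractor L \<rho> a K"
    and separation: "strong_separation L \<rho> a K"
    and \<gamma>: "\<gamma> = ln (real L) / (- ln \<rho>)"
    and pos: "\<And>n. 1 \<le> n \<Longrightarrow> 0 < \<phi> n"
    and b: "b = liminf (\<lambda>n. ereal (log \<rho> (\<phi> n) / real n))"
    and b_nonneg: "0 \<le> b"
  shows "hausdorff_dim K = ereal \<gamma> \<and>
         hausdorff_dim (recurrence_set K (ifs_shift L \<rho> a) \<phi>) = ereal \<gamma> / (1 + b)"
proof -
  interpret separated_ifs L \<rho> a K by unfold_locales fact+
  have "\<gamma> = similarity_dim" by (simp add: \<gamma> similarity_dim_def)
  then show ?thesis
    using hausdorff_dim_attractor hausdorff_dim_recurrence_set_le[OF pos b b_nonneg]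
      hausdorff_dim_recurrence_set_ge[OF pos b b_nonneg] by (auto intro: antisym)
qed

end
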